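(* Let $n\ge 0$ be an integer. The value of the tree series $\mathcal{S}$ at $x=[n]_q$ is the tree series $F^{(n)}$; that is, for every tree $T$, $\mathcal{S}_T|_{x=[n]_q}=F^{(n)}_T=\sum_c q^{\sigma(c)}$, the sum being over all decreasing $n$-colourings $c$ of $T$, i.e. decreasing colourings by $\{0,\dots,n\}$.
   Context: $q$ and $x$ are indeterminates; $[n]_q=\frac{q^n-1}{q-1}$. A tree is a finite rooted tree (finite connected acyclic graph with a distinguished vertex, the root), considered up to isomorphism. $\#T$ is the number of vertices of $T$, $\mathrm{aut}(T)$ is the order of its automorphism group, and $\bullet$ is the one-vertex tree. A tree series over a commutative $\mathbb{Q}$-algebra $R$ is a formal infinite sum $A=\sum_T A_T\,\frac{T}{\mathrm{aut}(T)}$ over all trees, with $A_T\in R$; $\bullet$ is also viewed as a tree series. For $\alpha\in R$, $(\Sigma_\alpha A)_T=\alpha^{\#T-1}A_T$. For tree series $A,B$, the tree series $\mathrm{Crls}\diamond(A,B)$ is defined by $$(\mathrm{Crls}\diamond(A,B))_T=\sum_{T_0}A_{T_0}\prod_{T'}B_{T'},$$ where $T_0$ runs over the subtrees (connected sets of vertices) of $T$ containing the root of $T$ (and rooted there), and $T'$ runs over the connected components of the complement of $T_0$ in $T$, each rooted at its vertex closest to the root of $T$ (an empty product is $1$). $\mathcal{S}$ denotes the unique tree series over $\mathbb{Q}(q)[x]$ satisfying $$q\,\Sigma_q \mathcal{S}-\mathrm{Crls}\diamond(\mathcal{S},-\bullet)=q\,(1+(q-1)x)\,\mathrm{Crls}\diamond(\bullet,\,q\,\Sigma_q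 \mathcal{S})-\bullet .$$ Order the vertices of a tree $T$ by the natural partial order $\le$ for which the root is the minimum ($u\le v$ iff $u$ lies on the path from $v$ to the root). A decreasing $n$-colouring of $T$ is a map $c$ from the vertices of $T$ to $\{0,\dots,n\}$ that is (weakly) decreasing: $u\le v$ implies $c(u)\ge c(v)$. $\sigma(c)$ is the sum of the values $c(v)$ over all vertices $v$. $F^{(n)}=\sum_T F^{(n)}_T\frac{T}{\mathrm{aut}(T)}$ with $F_T^{(n)}=\sum_c q^{\sigma(c)}$, the sum over decreasing $n$-colourings of $T$. *)

theory Defs
  imports
    "HOL-Library.FuncSet"
    "HOL-Computational_Algebra.Polynomial"
    "HOL-Computational_Algebra.Fraction_Field"
begin

section \<open>Finite rooted trees\<close>

text \<open>A simple graph with a distinguished vertex; the edges are stored as a symmetric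
  irreflexive relation. Since only finite graphs matter, the vertices may be taken in \<open>nat\<close>:
  every finite graph is isomorphic to one of this kind.\<close>

record rgraph =
  verts :: "nat set"
  edges :: "(nat \<times> nat) set"
  root_vertex :: nat

definition is_path :: "rgraph \<Rightarrow> nat list \<Rightarrow> bool" where
  "is_path G p \<longleftrightarrow>
     p \<noteq> [] \<and> distinct p \<and> set p \<subseteq> verts G \<and> successively (\<lambda>u v. (u, v) \<in> edges G) p"

definition edges_within :: "rgraph \<Rightarrow> nat set \<Rightarrow> (nat \<times> nat) set" where
  "edges_within G U = edges G \<inter> U \<times> U"

definition connected_set :: "rgraph \<Rightarrow> nat set \<Rightarrow> bool" where
  "connected_set G U \<longleftrightarrow> U \<noteq> {} \<and> (\<forall>u\<in>U. \<forall>v\<in>U. (u, v) \<in> (edges_within G U)\<^sup>*)"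

definition has_cycle :: "rgraph \<Rightarrow> bool" where
  "has_cycle G \<longleftrightarrow> (\<exists>p. is_path G p \<and> length p \<ge> 3 \<and> (last p, hd p) \<in> edges G)"

definition rooted_tree :: "rgraph \<Rightarrow> bool" where
  "rooted_tree G \<longleftrightarrow>
     finite (verts G) \<and> root_vertex G \<in> verts G \<and>
     edges G \<subseteq> verts G \<times> verts G \<and> sym (edges G) \<and> irrefl (edges G) \<and>
     connected_set G (verts G) \<and> \<not> has_cycle G"

definition rooted_iso :: "rgraph \<Rightarrow> rgraph \<Rightarrow> bool" where
  "rooted_iso G H \<longleftrightarrow>
     (\<exists>f. bij_betw f (verts G) (verts H) \<and> f (root_vertex G) = root_vertex H \<and>
       (\<forall>u\<in>verts G. \<forall>v\<in>verts G. (u, v) \<in> edges G \<longleftrightarrow> (f u, f v) \<in> edges H))"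

definition single_vertex :: rgraph where
  "single_vertex = \<lparr>verts = {0}, edges = {}, root_vertex = 0\<rparr>"

lemma rooted_tree_single_vertex: "rooted_tree single_vertex"
proof -
  have "\<not> has_cycle single_vertex"
    by (simp add: has_cycle_def single_vertex_def)
  then show ?thesis
    by (simp add: rooted_tree_def single_vertex_def connected_set_def irrefl_def sym_def)
qed

lemma rooted_iso_refl: "rooted_iso G G"
  unfolding rooted_iso_def by (rule exI[of _ id]) simp

lemma rooted_iso_sym:
  assumes "root_vertex G \<in> verts G" "rooted_iso G H"
  shows "rooted_iso H G"
proof -
  from assms(2) obtain f where f: "bij_betw f (verts G) (verts H)" "f (root_vertex G) = root_vertex H"
    and e: "\<And>u v. u \<in> verts G \<Longrightarrow> v \<in> verts G \<Longrightarrow> (u, v) \<in> edges G \<longleftrightarrow> (f u, f v) \<in> edges H"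
    unfolding rooted_iso_def by blast
  let ?g = "inv_into (verts G) f"
  have g: "bij_betw ?g (verts H) (verts G)"
    using f(1) by (rule bij_betw_inv_into)
  have r: "?g (root_vertex H) = root_vertex G"
    using bij_betw_inv_into_left[OF f(1) assms(1)] f(2) by simp
  have "(u, v) \<in> edges H \<longleftrightarrow> (?g u, ?g v) \<in> edges G"
    if "u \<in> verts H" "v \<in> verts H" for u v
    using e[of "?g u" "?g v"] that bij_betwE[OF g] bij_betw_inv_into_right[OF f(1)] by simp
  with g r show ?thesis
    unfolding rooted_iso_def by blast
qed

lemma rooted_iso_trans:
  assumes "rooted_iso G H" "rooted_iso H K"
  shows "rooted_iso G K"
proof -
  from assms(1) obtain f where f: "bij_betw f (verts G) (verts H)" "f (root_vertex G) = root_vertex H"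
    "\<And>u v. u \<in> verts G \<Longrightarrow> v \<in> verts G \<Longrightarrow> (u, v) \<in> edges G \<longleftrightarrow> (f u, f v) \<in> edges H"
    unfolding rooted_iso_def by blast
  from assms(2) obtain g where g: "bij_betw g (verts H) (verts K)" "g (root_vertex H) = root_vertex K"
    "\<And>u v. u \<in> verts H \<Longrightarrow> v \<in> verts H \<Longrightarrow> (u, v) \<in> edges H \<longleftrightarrow> (g u, g v) \<in> edges K"
    unfolding rooted_iso_def by blast
  show ?thesis
    unfolding rooted_iso_def
  proof (intro exI[of _ "g \<circ> f"] conjI ballI)
    show "bij_betw (g \<circ> f) (verts G) (verts K)"
      using f(1) g(1) by (rule bij_betw_trans)
    show "(g \<circ> f) (root_vertex G) = root_vertex K"
      using f(2) g(2) by simp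
    show "(u, v) \<in> edges G \<longleftrightarrow> ((g \<circ> f) u, (g \<circ> f) v) \<in> edges K"
      if "u \<in> verts G" "v \<in> verts G" for u v
      using f(3)[OF that] g(3)[of "f u" "f v"] bij_betwE[OF f(1)] that by simp
  qed
qed

text \<open>Isomorphism classes of finite rooted trees. \<open>tree_class G\<close> is the class of \<open>G\<close>, and
  \<open>rep_tree T\<close> is some member of the class \<open>T\<close>; everything computed from \<open>rep_tree T\<close>
  below is invariant under isomorphism, so the choice is immaterial.\<close>

quotient_type tree = rgraph / partial: "\<lambda>G H. rooted_tree G \<and> rooted_tree H \<and> rooted_iso G H"
  morphisms rep_tree tree_class
proof (rule part_equivpI)
  show "\<exists>G. rooted_tree G \<and> rooted_tree G \<and> rooted_iso G G"
    using rooted_tree_single_vertex rooted_iso_refl by blast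
  show "symp (\<lambda>G H. rooted_tree G \<and> rooted_tree H \<and> rooted_iso G H)"
    by (rule sympI) (auto intro: rooted_iso_sym simp: rooted_tree_def)
  show "transp (\<lambda>G H. rooted_tree G \<and> rooted_tree H \<and> rooted_iso G H)"
    by (rule transpI) (auto intro: rooted_iso_trans)
qed

definition num_verts :: "tree \<Rightarrow> nat" where
  "num_verts T = card (verts (rep_tree T))"


section \<open>Subtrees and components\<close>

definition induced :: "rgraph \<Rightarrow> nat set \<Rightarrow> nat \<Rightarrow> rgraph" where
  "induced G U r = \<lparr>verts = U, edges = edges_within G U, root_vertex = r\<rparr>"

definition root_subtrees :: "rgraph \<Rightarrow> nat set set" where
  "root_subtrees G = {U. U \<subseteq> verts G \<and> root_vertex G \<in> U \<and> connected_set G U}"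

definition components_of :: "rgraph \<Rightarrow> nat set \<Rightarrow> nat set set" where
  "components_of G W = W // ((edges_within G W)\<^sup>* \<inter> W \<times> W)"

definition graph_dist :: "rgraph \<Rightarrow> nat \<Rightarrow> nat \<Rightarrow> nat" where
  "graph_dist G u v = (LEAST k. (u, v) \<in> edges G ^^ k)"

definition closest_to_root :: "rgraph \<Rightarrow> nat set \<Rightarrow> nat" where
  "closest_to_root G C = (ARG_MIN (graph_dist G (root_vertex G)) v. v \<in> C)"


section \<open>Tree series\<close>

text \<open>The series \<open>\<Sum>\<^sub>T A\<^sub>T T / aut(T)\<close> is represented by its family of normalised coefficients
  \<open>A\<^sub>T\<close>, so that the factors \<open>1 / aut(T)\<close> do not appear. The one-vertex tree has only the trivial
  automorphism, whence the coefficients of \<open>bullet\<close>.\<close>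

type_synonym 'a tree_series = "tree \<Rightarrow> 'a"

definition bullet :: "'a::comm_ring_1 tree_series" where
  "bullet T = (if T = tree_class single_vertex then 1 else 0)"

definition suspension :: "'a::comm_ring_1 \<Rightarrow> 'a tree_series \<Rightarrow> 'a tree_series" where
  "suspension \<alpha> A T = \<alpha> ^ (num_verts T - 1) * A T"

definition crls_graph :: "'a::comm_ring_1 tree_series \<Rightarrow> 'a tree_series \<Rightarrow> rgraph \<Rightarrow> 'a" where
  "crls_graph A B G =
     (\<Sum>U\<in>root_subtrees G. A (tree_class (induced G U (root_vertex G))) *
        (\<Prod>C\<in>components_of G (verts G - U).
           B (tree_class (induced G C (closest_to_root G C)))))"

definition crls :: "'a::comm_ring_1 tree_series \<Rightarrow> 'a tree_series \<Rightarrow> 'a tree_series" where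
  "crls A B T = crls_graph A B (rep_tree T)"


section \<open>The series over \<open>\<rat>(q)[x]\<close>\<close>

definition qelem :: "rat poly fract" where
  "qelem = Fract [:0, 1:] 1"

definition qint :: "nat \<Rightarrow> rat poly fract" where
  "qint n = (qelem ^ n - 1) / (qelem - 1)"

definition qx :: "rat poly fract poly" where
  "qx = [:qelem:]"

definition xvar :: "rat poly fract poly" where
  "xvar = [:0, 1:]"

definition S_equation :: "rat poly fract poly tree_series \<Rightarrow> bool" where
  "S_equation A \<longleftrightarrow>
     (\<lambda>T. qx * suspension qx A T - crls A (\<lambda>T'. - bullet T') T) =
     (\<lambda>T. qx * (1 + (qx - 1) * xvar) * crls bullet (\<lambda>T'. qx * suspension qx A T') T - bullet T)"

definition S_series :: "rat poly fract poly tree_series" where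
  "S_series = (THE A. S_equation A)"

definition eval_series :: "rat poly fract \<Rightarrow> rat poly fract poly tree_series
    \<Rightarrow> rat poly fract tree_series" where
  "eval_series a A T = poly (A T) a"


section \<open>Decreasing colourings\<close>

definition below :: "rgraph \<Rightarrow> nat \<Rightarrow> nat \<Rightarrow> bool" where
  "below G u v \<longleftrightarrow> (\<exists>p. is_path G p \<and> hd p = v \<and> last p = root_vertex G \<and> u \<in> set p)"

definition decreasing_colourings :: "nat \<Rightarrow> rgraph \<Rightarrow> (nat \<Rightarrow> nat) set" where
  "decreasing_colourings n G =
     {c \<in> verts G \<rightarrow>\<^sub>E {0..n}. \<forall>u\<in>verts G. \<forall>v\<in>verts G. below G u v \<longrightarrow> c u \<ge> c v}"

definition F_graph :: "nat \<Rightarrow> rgraph \<Rightarrow> rat poly fract" where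
  "F_graph n G = (\<Sum>c\<in>decreasing_colourings n G. qelem ^ (\<Sum>v\<in>verts G. c v))"

definition F_series :: "nat \<Rightarrow> rat poly fract tree_series" where
  "F_series n T = F_graph n (rep_tree T)"

end

theory Submission
  imports Defs
begin

text \<open>The \<open>T\<close>-coefficient of the functional equation has the form
  \<open>(q\<^bsup>#T\<^esup> - 1) S\<^sub>T = \<dots>\<close> with a right-hand side that only involves smaller trees,
  so it has a unique solution both over \<open>\<rat>(q)[x]\<close> and, after evaluation at \<open>x = [n]\<^sub>q\<close> (where
  \<open>1 + (q - 1) x = q\<^sup>n\<close>), over \<open>\<rat>(q)\<close>. The colouring series solves the evaluated equation:
  \<open>q \<Sigma>\<^sub>q F\<close> counts the colourings by \<open>{1..n+1}\<close>; \<open>Crls\<diamond>(F, -\<bullet>)\<close> is an inclusion-exclusion over leaves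
  of colour \<open>0\<close> and counts (up to \<open>\<bullet>\<close>) the colourings by \<open>{1..n}\<close>; their difference counts the
  colourings by \<open>{1..n+1}\<close> whose root has colour \<open>n + 1\<close>, which factorises over the components of
  the complement of the root.\<close>

section \<open>Isomorphism classes\<close>

lemma rooted_tree_rep_tree: "rooted_tree (rep_tree T)"
  using Quotient3_rep_reflp[OF Quotient3_tree, of T] by simp

lemma tree_class_rep_tree: "tree_class (rep_tree T) = T"
  using Quotient3_abs_rep[OF Quotient3_tree] .

lemma tree_class_eq_iff:
  assumes "rooted_tree G" "rooted_tree H"
  shows "tree_class G = tree_class H \<longleftrightarrow> rooted_iso G H"
  using Quotient3_rel[OF Quotient3_tree, of G H] assms rooted_iso_refl by auto

lemma rooted_iso_rep_tree_class:
  assumes "rooted_tree G"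
  shows "rooted_iso (rep_tree (tree_class G)) G"
  using assms rooted_tree_rep_tree tree_class_eq_iff tree_class_rep_tree by blast

lemma rooted_iso_card: "rooted_iso G H \<Longrightarrow> card (verts G) = card (verts H)"
  by (auto simp: rooted_iso_def bij_betw_same_card)

lemma num_verts_tree_class: "rooted_tree G \<Longrightarrow> num_verts (tree_class G) = card (verts G)"
  by (simp add: num_verts_def rooted_iso_card rooted_iso_rep_tree_class)

lemma num_verts_pos: "num_verts T > 0"
  using rooted_tree_rep_tree[of T] by (auto simp: num_verts_def rooted_tree_def card_gt_0_iff)

text \<open>Irreflexivity rules out a loop at the only vertex, so the number of vertices alone
  decides. Hence coefficients of \<open>bullet\<close> can be read off by counting vertices.\<close>

lemma rooted_iso_single_vertex_iff:
  assumes "rooted_tree G"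
  shows "rooted_iso G single_vertex \<longleftrightarrow> card (verts G) = 1"
proof
  show "card (verts G) = 1" if "rooted_iso G single_vertex"
    using rooted_iso_card[OF that] by (simp add: single_vertex_def)
  assume "card (verts G) = 1"
  moreover have "root_vertex G \<in> verts G" "irrefl (edges G)"
    using assms by (auto simp: rooted_tree_def)
  ultimately have "verts G = {root_vertex G}" "irrefl (edges G)"
    by (auto simp: card_1_singleton_iff)
  then show "rooted_iso G single_vertex"
    unfolding rooted_iso_def
    by (intro exI[of _ "\<lambda>_. 0"]) (auto simp: single_vertex_def bij_betw_def irrefl_def)
qed

lemma bullet_tree_class:
  assumes "rooted_tree G"
  shows "bullet (tree_class G) = (if card (verts G) = 1 then 1 else 0)"
  using tree_class_eq_iff[OF assms rooted_tree_single_vertex] rooted_iso_single_vertex_iff[OF assms]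
  by (simp add: bullet_def)


section \<open>Paths in rooted trees\<close>

lemma is_path_singleton: "is_path G [x] \<longleftrightarrow> x \<in> verts G"
  by (simp add: is_path_def)

lemma is_path_Cons:
  assumes "p \<noteq> []"
  shows "is_path G (x # p) \<longleftrightarrow> x \<in> verts G \<and> x \<notin> set p \<and> (x, hd p) \<in> edges G \<and> is_path G p"
  using assms by (cases p) (auto simp: is_path_def)

lemma is_path_suffix: "is_path G (p @ q) \<Longrightarrow> q \<noteq> [] \<Longrightarrow> is_path G q"
  by (auto simp: is_path_def successively_append_iff)

lemma is_path_prefix: "is_path G (p @ q) \<Longrightarrow> p \<noteq> [] \<Longrightarrow> is_path G p"
  by (auto simp: is_path_def successively_append_iff)

lemma is_path_map:
  assumes "is_path G p" "bij_betw f (verts G) (verts H)"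
    "\<And>u v. u \<in> verts G \<Longrightarrow> v \<in> verts G \<Longrightarrow> (u, v) \<in> edges G \<longleftrightarrow> (f u, f v) \<in> edges H"
  shows "is_path H (map f p)"
proof -
  have p: "p \<noteq> []" "distinct p" "set p \<subseteq> verts G" "successively (\<lambda>u v. (u, v) \<in> edges G) p"
    using assms(1) by (auto simp: is_path_def)
  have "distinct (map f p)"
    using p(2,3) assms(2) by (auto simp: distinct_map bij_betw_def intro: inj_on_subset)
  moreover have "successively (\<lambda>u v. (u, v) \<in> edges H) (map f p)"
    unfolding successively_map
    by (rule successively_mono[OF p(4)]) (use p(3) assms(3) in auto)
  ultimately show ?thesis
    using p assms(2) by (auto simp: is_path_def bij_betw_def)
qed

lemma is_path_rtrancl:
  assumes "is_path G p" "set p \<subseteq> U"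
  shows "(hd p, last p) \<in> (edges_within G U)\<^sup>*"
  using assms
proof (induction p)
  case (Cons x p)
  show ?case
  proof (cases "p = []")
    case False
    then have "(x, hd p) \<in> edges_within G U" "(hd p, last p) \<in> (edges_within G U)\<^sup>*"
      using Cons is_path_Cons[OF False, of G x] by (auto simp: edges_within_def)
    then show ?thesis
      using False by (simp add: converse_rtrancl_into_rtrancl)
  qed auto
qed (simp add: is_path_def)

lemma connected_set_path:
  assumes "connected_set G U" "U \<subseteq> verts G" "v \<in> U" "w \<in> U"
  shows "\<exists>p. is_path G p \<and> hd p = v \<and> last p = w \<and> set p \<subseteq> U"
proof -
  have "(v, w) \<in> (edges_within G U)\<^sup>*"
    using assms by (auto simp: connected_set_def)
  then show ?thesis
  proof (induction rule: converse_rtrancl_induct)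
    case base
    show ?case
      using assms by (intro exI[of _ "[w]"]) (auto simp: is_path_singleton)
  next
    case (step y z)
    then obtain p where p: "is_path G p" "hd p = z" "last p = w" "set p \<subseteq> U"
      by blast
    have y: "y \<in> U" "(y, z) \<in> edges G"
      using step(1) by (auto simp: edges_within_def)
    have ne: "p \<noteq> []"
      using p(1) by (auto simp: is_path_def)
    show ?case
    \<comment> \<open>Prepending \<open>y\<close> would create a repetition if \<open>p\<close>
      already visits \<open>y\<close>; the suffix of \<open>p\<close> starting at \<open>y\<close>
      is used instead.\<close>
    proof (cases "y \<in> set p")
      case True
      then obtain a b where ab: "p = a @ y # b"
        by (meson split_list)
      then show ?thesis
        using p is_path_suffix[of G a "y # b"] by (intro exI[of _ "y # b"]) auto
    next
      case False
      then show ?thesis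
        using p y ne assms(2) by (intro exI[of _ "y # p"]) (auto simp: is_path_Cons)
    qed
  qed
qed

section \<open>Unique paths, root paths and the tree order\<close>

locale rtree =
  fixes G :: rgraph
  assumes tree: "rooted_tree G"
begin

abbreviation "V \<equiv> verts G"
abbreviation "E \<equiv> edges G"
abbreviation "r \<equiv> root_vertex G"

lemma finite_V: "finite V" and root_in_V: "r \<in> V" and E_subset: "E \<subseteq> V \<times> V"
  and sym_E: "sym E" and irrefl_E: "irrefl E" and connected_V: "connected_set G V"
  and acyclic_G: "\<not> has_cycle G"
  using tree by (auto simp: rooted_tree_def)

text \<open>Two paths that leave \<open>x\<close> by different edges and meet again close up to a cycle at their
  first common vertex.\<close>

lemma paths_diverge_False:
  assumes x: "x \<in> V" "x \<notin> set p" "x \<notin> set q" and e: "(x, hd p) \<in> E" "(x, hd q) \<in> E"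
    and p: "is_path G p" and q: "is_path G q" and last: "last p = last q" and ne: "hd p \<noteq> hd q"
  shows False
proof -
  have "p \<noteq> []" "q \<noteq> []"
    using p q by (auto simp: is_path_def)
  then have "\<exists>a\<in>set p. a \<in> set q"
    using last by (metis last_in_set)
  then obtain p1 a p2 where ps: "p = p1 @ a # p2" "a \<in> set q" "\<forall>y\<in>set p1. y \<notin> set q"
    by (rule split_list_first_propE)
  obtain q1 q2 where qs: "q = q1 @ a # q2"
    using ps(2) by (meson split_list)
  \<comment> \<open>From \<open>x\<close> along \<open>p\<close> to the first vertex
    \<open>a\<close> that also lies on \<open>q\<close>, then back along \<open>q\<close> towards
    \<open>x\<close>. Since \<open>a\<close> is the first such vertex, \<open>p1\<close> is disjoint
    from \<open>q1\<close>.\<close>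
  define c where "c = (x # p1) @ a # rev q1"
  have p1: "successively (\<lambda>u v. (u, v) \<in> E) (x # p1 @ [a])"
    using is_path_prefix[of G "p1 @ [a]" p2] p e(1) ps(1)
    by (cases p1) (auto simp: is_path_def successively_Cons)
  have q1: "successively (\<lambda>u v. (u, v) \<in> E) (q1 @ [a])"
    using is_path_prefix[of G "q1 @ [a]" q2] q qs by (simp add: is_path_def)
  have "successively (\<lambda>u v. (v, u) \<in> E) (q1 @ [a])"
    by (rule successively_mono[OF q1]) (use sym_E in \<open>auto dest: symD\<close>)
  then have q2: "successively (\<lambda>u v. (u, v) \<in> E) (a # rev q1)"
    using successively_rev[of "\<lambda>u v. (u, v) \<in> E" "q1 @ [a]"] by simp
  have "successively (\<lambda>u v. (u, v) \<in> E) ((x # p1) @ (a # rev q1))"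
    using p1 q2 by (auto simp: successively_Cons successively_append_iff hd_append)
  moreover have "distinct c"
    using p q ps qs x by (auto simp: c_def is_path_def)
  moreover have "set c \<subseteq> V"
    using p q ps qs x by (auto simp: c_def is_path_def)
  ultimately have "is_path G c"
    by (auto simp: c_def is_path_def)
  \<comment> \<open>If \<open>p1\<close> and \<open>q1\<close> were both empty, both paths would
    start at \<open>a\<close>, contrary to \<open>hd p \<noteq> hd q\<close>.\<close>
  moreover have "length c \<ge> 3"
    using ne ps(1) qs by (cases p1; cases q1) (auto simp: c_def)
  moreover have "last c = hd q"
    by (cases q1) (auto simp: c_def qs)
  then have "(last c, hd c) \<in> E"
    using e(2) sym_E by (auto simp: c_def dest: symD)
  ultimately show False
    using acyclic_G by (auto simp: has_cycle_def)
qed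

text \<open>Induction peels off the common first vertex; by the divergence lemma the next vertices
  agree as well.\<close>

lemma path_unique:
  assumes "is_path G p" "is_path G q" "hd p = hd q" "last p = last q"
  shows "p = q"
  using assms
proof (induction p arbitrary: q)
  case Nil
  then show ?case by (simp add: is_path_def)
next
  case (Cons x p)
  then obtain q' where q: "q = x # q'"
    by (cases q) (auto simp: is_path_def)
  show ?case
  \<comment> \<open>If one tail is empty, both paths end in \<open>x\<close>; as paths do not repeat
    vertices, the other tail is empty too.\<close>
  proof (cases "p = [] \<or> q' = []")
    case True
    then show ?thesis
      using Cons.prems q by (cases p; cases q') (auto simp: is_path_def split: if_splits)
  next
    case False
    then have *: "is_path G p" "is_path G q'" "last p = last q'" "x \<in> V" "x \<notin> set p" "x \<notin> set q'"
      "(x, hd p) \<in> E" "(x, hd q') \<in> E"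
      using Cons.prems q is_path_Cons[of p G x] is_path_Cons[of q' G x] by auto
    then have "hd p = hd q'"
      using paths_diverge_False by blast
    then show ?thesis
      using Cons.IH[of q'] * q by simp
  qed
qed

text \<open>The path runs from \<open>v\<close> down to the root, so its suffixes are the root paths
  of the vertices below \<open>v\<close>.\<close>

definition root_path :: "nat \<Rightarrow> nat list" where
  "root_path v = (THE p. is_path G p \<and> hd p = v \<and> last p = r)"

lemma root_path_eqI:
  assumes "is_path G p" "last p = r"
  shows "root_path (hd p) = p"
  unfolding root_path_def using assms path_unique by (intro the_equality) auto

text \<open>Root subtrees are closed downwards: connectedness gives a path to the root inside
  \<open>U\<close>, and uniqueness makes it the root path.\<close>

lemma root_path_subset:
  assumes "U \<in> root_subtrees G" "v \<in> U"
  shows "set (root_path v) \<subseteq> U"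
proof -
  obtain p where "is_path G p" "hd p = v" "last p = r" "set p \<subseteq> U"
    using connected_set_path[of G U v r] assms by (auto simp: root_subtrees_def)
  then show ?thesis
    using root_path_eqI by metis
qed

lemma root_path:
  assumes "v \<in> V"
  shows "is_path G (root_path v)" "hd (root_path v) = v" "last (root_path v) = r"
    "root_path v \<noteq> []"
proof -
  obtain p where "is_path G p" "hd p = v" "last p = r"
    using connected_set_path[OF connected_V _ assms root_in_V] by auto
  then show "is_path G (root_path v)" "hd (root_path v) = v" "last (root_path v) = r"
    using root_path_eqI by auto
  then show "root_path v \<noteq> []"
    by (auto simp: is_path_def)
qed

lemma self_in_root_path: "v \<in> V \<Longrightarrow> v \<in> set (root_path v)"
  using root_path[of v] by (metis list.set_sel(1))

lemma root_in_root_path: "v \<in> V \<Longrightarrow> r \<in> set (root_path v)"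
  using root_path[of v] by (metis last_in_set)

lemma below_iff: "v \<in> V \<Longrightarrow> below G u v \<longleftrightarrow> u \<in> set (root_path v)"
  using root_path[of v] root_path_eqI unfolding below_def by metis

lemma below_root: "v \<in> V \<Longrightarrow> below G r v"
  by (simp add: below_iff root_in_root_path)

lemma root_path_root: "root_path r = [r]"
  using root_path_eqI[of "[r]"] root_in_V by (simp add: is_path_singleton)

lemma root_path_suffix:
  assumes "v \<in> V" "root_path v = p @ q" "q \<noteq> []"
  shows "root_path (hd q) = q"
  using root_path[OF assms(1)] assms is_path_suffix by (intro root_path_eqI) auto

text \<open>The root path of \<open>u\<close> is a proper suffix of that of \<open>v\<close>. The
  length serves as a depth that strictly increases along the order.\<close>

lemma length_root_path_less:
  assumes "v \<in> V" "u \<in> set (root_path v)" "u \<noteq> v"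
  shows "length (root_path u) < length (root_path v)"
proof -
  obtain p q where pq: "root_path v = p @ u # q"
    using assms(2) by (meson split_list)
  moreover have "p \<noteq> []"
    using root_path(2)[OF assms(1)] assms(3) pq by (cases p) auto
  ultimately show ?thesis
    using root_path_suffix[OF assms(1) pq] by simp
qed

text \<open>If \<open>v\<close> is not on the root path of \<open>u\<close>, prepending it to that
  path yields the root path of \<open>v\<close>, which passes through \<open>u\<close>.\<close>

lemma edge_below:
  assumes "(u, v) \<in> E"
  shows "below G u v \<or> below G v u"
proof (cases "v \<in> set (root_path u)")
  case True
  then show ?thesis
    using assms E_subset below_iff by auto
next
  case False
  have V: "u \<in> V" "v \<in> V" "(v, u) \<in> E"
    using assms E_subset sym_E by (auto dest: symD)
  then have "is_path G (v # root_path u)"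
    using False root_path[OF V(1)] by (simp add: is_path_Cons)
  then have "root_path v = v # root_path u"
    using root_path_eqI[of "v # root_path u"] root_path[OF V(1)] by simp
  then show ?thesis
    using V self_in_root_path below_iff by simp
qed

end


section \<open>Induced subtrees and components\<close>

lemma induced_simps [simp]:
  "verts (induced G U s) = U" "edges (induced G U s) = edges_within G U"
  "root_vertex (induced G U s) = s"
  by (auto simp: induced_def)

lemma edges_within_induced: "edges_within (induced G U s) U = edges_within G U"
  by (auto simp: edges_within_def)

lemma is_path_induced:
  assumes "U \<subseteq> verts G"
  shows "is_path (induced G U s) p \<longleftrightarrow> is_path G p \<and> set p \<subseteq> U"
proof -
  have "successively (\<lambda>u v. (u, v) \<in> edges_within G U) p \<longleftrightarrow>
      successively (\<lambda>u v. (u, v) \<in> edges G) p" if "set p \<subseteq> U"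
    by (rule successively_cong) (use that in \<open>auto simp: edges_within_def\<close>)
  then show ?thesis
    using assms by (auto simp: is_path_def)
qed

lemma below_induced:
  assumes "U \<subseteq> verts G"
  shows "below (induced G U s) u v \<longleftrightarrow>
    (\<exists>p. is_path G p \<and> set p \<subseteq> U \<and> hd p = v \<and> last p = s \<and> u \<in> set p)"
  using is_path_induced[OF assms] by (auto simp: below_def)

context rtree
begin

lemma rooted_tree_induced:
  assumes U: "U \<subseteq> V" "connected_set G U" and s: "s \<in> U"
  shows "rooted_tree (induced G U s)"
proof -
  have "\<not> has_cycle (induced G U s)"
    using acyclic_G is_path_induced[OF U(1)] by (auto simp: has_cycle_def edges_within_def)
  moreover have "sym (edges_within G U)" "irrefl (edges_within G U)"
    using sym_E irrefl_E by (auto simp: edges_within_def sym_def irrefl_def)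
  ultimately show ?thesis
    using U s finite_V finite_subset
    by (auto simp: rooted_tree_def connected_set_def edges_within_induced)
       (auto simp: edges_within_def)
qed

lemma rooted_tree_root_subtree: "U \<in> root_subtrees G \<Longrightarrow> rooted_tree (induced G U r)"
  by (simp add: root_subtrees_def rooted_tree_induced)

lemma finite_root_subtrees: "finite (root_subtrees G)"
  using finite_V by (auto simp: root_subtrees_def)

lemma V_root_subtree: "V \<in> root_subtrees G"
  by (simp add: root_subtrees_def root_in_V connected_V)

lemma tree_class_induced_V: "tree_class (induced G V r) = tree_class G"
proof -
  have "rooted_iso (induced G V r) G"
    unfolding rooted_iso_def
    by (intro exI[of _ id]) (auto simp: edges_within_def)
  then show ?thesis
    using tree_class_eq_iff tree rooted_tree_root_subtree[OF V_root_subtree] by blast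
qed

text \<open>The root path of a vertex of \<open>U\<close> stays inside \<open>U\<close>, so it also
  determines the order of the induced tree.\<close>

lemma below_root_subtree:
  assumes "U \<in> root_subtrees G" "v \<in> U"
  shows "below (induced G U r) u v \<longleftrightarrow> below G u v"
proof -
  have U: "U \<subseteq> V"
    using assms by (auto simp: root_subtrees_def)
  have v: "v \<in> V"
    using U assms(2) by auto
  show ?thesis
    unfolding below_induced[OF U] below_iff[OF v]
  proof
    assume "\<exists>p. is_path G p \<and> set p \<subseteq> U \<and> hd p = v \<and> last p = r \<and> u \<in> set p"
    then show "u \<in> set (root_path v)"
      using root_path_eqI by metis
  next
    assume "u \<in> set (root_path v)"
    then show "\<exists>p. is_path G p \<and> set p \<subseteq> U \<and> hd p = v \<and> last p = r \<and> u \<in> set p"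
      using root_path[OF v] root_path_subset[OF assms] by (intro exI[of _ "root_path v"]) simp
  qed
qed

section \<open>Connected components of a set of vertices\<close>

context
  fixes W assumes W: "W \<subseteq> V"
begin

lemma component_equiv: "equiv W ((edges_within G W)\<^sup>* \<inter> W \<times> W)"
proof (rule equivI)
  have "sym (edges_within G W)"
    using sym_E by (auto simp: edges_within_def sym_def)
  then have "sym ((edges_within G W)\<^sup>*)"
    by (rule sym_rtrancl)
  then show "sym ((edges_within G W)\<^sup>* \<inter> W \<times> W)"
    by (auto simp: sym_def)
qed (auto simp: refl_on_def trans_def)

lemma Union_components: "\<Union> (components_of G W) = W"
  unfolding components_of_def by (rule Union_quotient[OF component_equiv])

lemma components_disjoint: "C \<in> components_of G W \<Longrightarrow> D \<in> components_of G W \<Longrightarrow> C = D \<or> C \<inter> D = {}"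
  unfolding components_of_def by (rule quotient_disj[OF component_equiv])

lemma component_nonempty: "C \<in> components_of G W \<Longrightarrow> C \<noteq> {}"
  unfolding components_of_def by (rule in_quotient_imp_non_empty[OF component_equiv])

lemma component_subset: "C \<in> components_of G W \<Longrightarrow> C \<subseteq> W"
  unfolding components_of_def by (rule in_quotient_imp_subset[OF component_equiv])

lemma finite_components: "finite (components_of G W)"
  using Union_components finite_V W by (metis finite_UnionD finite_subset)

lemma component_closed:
  assumes "C \<in> components_of G W" "u \<in> C" "(u, v) \<in> (edges_within G W)\<^sup>*" "v \<in> W"
  shows "v \<in> C"
  using assms component_subset[OF assms(1)] unfolding components_of_def
  by (intro in_quotient_imp_closed[OF component_equiv, of C u v]) auto

lemma component_connected:
  assumes C: "C \<in> components_of G W"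
  shows "connected_set G C"
proof -
  have "(u, v) \<in> (edges_within G C)\<^sup>*" if "u \<in> C" "v \<in> C" for u v
  proof -
    have "(u, v) \<in> (edges_within G W)\<^sup>*"
      using in_quotient_imp_in_rel[OF component_equiv, of C u v] C that
      by (auto simp: components_of_def)
    \<comment> \<open>Membership in \<open>C\<close> is carried through the induction so that each
      further edge has both ends in \<open>C\<close>.\<close>
    then have "(u, v) \<in> (edges_within G C)\<^sup>* \<and> v \<in> C"
    proof (induction rule: rtrancl_induct)
      case base
      then show ?case using that by simp
    next
      case (step y z)
      have "z \<in> C"
        using step component_closed[OF C, of y z] by (auto simp: edges_within_def)
      then have "(y, z) \<in> edges_within G C"
        using step by (auto simp: edges_within_def)
      then show ?case
        using step \<open>z \<in> C\<close> by (meson rtrancl.rtrancl_into_rtrancl)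
    qed
    then show ?thesis ..
  qed
  then show ?thesis
    using component_nonempty[OF C] by (simp add: connected_set_def)
qed

lemma closest_to_root_in: "C \<in> components_of G W \<Longrightarrow> closest_to_root G C \<in> C"
  using component_nonempty unfolding closest_to_root_def by (metis arg_min_natI ex_in_conv)

lemma rooted_tree_component:
  "C \<in> components_of G W \<Longrightarrow> rooted_tree (induced G C (closest_to_root G C))"
  using component_subset W component_connected closest_to_root_in by (intro rooted_tree_induced) auto

end

end

section \<open>Generating functions of decreasing colourings\<close>

definition decreasing :: "rgraph \<Rightarrow> (nat \<Rightarrow> nat) \<Rightarrow> bool" where
  "decreasing G c \<longleftrightarrow> (\<forall>u\<in>verts G. \<forall>v\<in>verts G. below G u v \<longrightarrow> c v \<le> c u)"

text \<open>The palette is a parameter because the proof compares the palettes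
  \<open>{0..n}\<close>, \<open>{1..n}\<close> and \<open>{1..Suc n}\<close>.\<close>

definition colourings :: "nat set \<Rightarrow> rgraph \<Rightarrow> (nat \<Rightarrow> nat) set" where
  "colourings A G = {c \<in> verts G \<rightarrow>\<^sub>E A. decreasing G c}"

definition weight :: "'a::comm_ring_1 \<Rightarrow> nat set \<Rightarrow> (nat \<Rightarrow> nat) \<Rightarrow> 'a" where
  "weight q U c = q ^ (\<Sum>v\<in>U. c v)"

definition colouring_gf :: "'a::comm_ring_1 \<Rightarrow> nat set \<Rightarrow> rgraph \<Rightarrow> 'a" where
  "colouring_gf q A G = (\<Sum>c\<in>colourings A G. weight q (verts G) c)"

lemma F_graph_eq: "F_graph n G = colouring_gf qelem {0..n} G"
  by (simp add: F_graph_def colouring_gf_def weight_def colourings_def decreasing_def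
      decreasing_colourings_def)

lemma below_iso_imp:
  assumes "bij_betw f (verts G) (verts H)" "f (root_vertex G) = root_vertex H"
    "\<And>u v. u \<in> verts G \<Longrightarrow> v \<in> verts G \<Longrightarrow> (u, v) \<in> edges G \<longleftrightarrow> (f u, f v) \<in> edges H"
    and "below G u v"
  shows "below H (f u) (f v)"
proof -
  obtain p where p: "is_path G p" "hd p = v" "last p = root_vertex G" "u \<in> set p"
    using assms(4) by (auto simp: below_def)
  then have "p \<noteq> []"
    by auto
  then show ?thesis
    using p assms(2) is_path_map[OF p(1) assms(1,3)] unfolding below_def
    by (intro exI[of _ "map f p"]) (auto simp: hd_map last_map)
qed

text \<open>Colourings are transported along the isomorphism and its inverse, both of which preserve
  the order. This makes the choice of representatives immaterial.\<close>

lemma colouring_gf_iso: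
  assumes G: "rooted_tree G" and iso: "rooted_iso G H"
  shows "colouring_gf q A G = colouring_gf q A H"
proof -
  from iso obtain f where f: "bij_betw f (verts G) (verts H)" "f (root_vertex G) = root_vertex H"
    and e: "\<And>u v. u \<in> verts G \<Longrightarrow> v \<in> verts G \<Longrightarrow> (u, v) \<in> edges G \<longleftrightarrow> (f u, f v) \<in> edges H"
    unfolding rooted_iso_def by blast
  define g where "g = inv_into (verts G) f"
  have g: "bij_betw g (verts H) (verts G)"
    using f(1) unfolding g_def by (rule bij_betw_inv_into)
  have gf: "g (f v) = v" if "v \<in> verts G" for v
    using bij_betw_inv_into_left[OF f(1)] that by (simp add: g_def)
  have fg: "f (g v) = v" if "v \<in> verts H" for v
    using bij_betw_inv_into_right[OF f(1)] that by (simp add: g_def)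
  have fV: "f v \<in> verts H" if "v \<in> verts G" for v
    using f(1) that by (auto simp: bij_betw_def)
  have gV: "g v \<in> verts G" if "v \<in> verts H" for v
    using g that by (auto simp: bij_betw_def)
  have rg: "g (root_vertex H) = root_vertex G"
    using gf[of "root_vertex G"] f(2) G by (simp add: rooted_tree_def)
  have eg: "(u, v) \<in> edges H \<longleftrightarrow> (g u, g v) \<in> edges G" if "u \<in> verts H" "v \<in> verts H" for u v
    using e[of "g u" "g v"] that by (simp add: fg gV)
  have bf: "below G u v \<Longrightarrow> below H (f u) (f v)" for u v
    using below_iso_imp[OF f e] .
  have bg: "below H u v \<Longrightarrow> below G (g u) (g v)" for u v
    using below_iso_imp[OF g rg eg] .
  show ?thesis
    unfolding colouring_gf_def
  proof (rule sum.reindex_bij_witness[of _ "\<lambda>c. \<lambda>v\<in>verts G. c (f v)" "\<lambda>c. \<lambda>v\<in>verts H. c (g v)"])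
    fix c assume "c \<in> colourings A G"
    then have c: "c \<in> verts G \<rightarrow>\<^sub>E A" "decreasing G c"
      by (auto simp: colourings_def)
    show "(\<lambda>v\<in>verts G. (\<lambda>v\<in>verts H. c (g v)) (f v)) = c"
      using c(1) by (auto simp: fun_eq_iff gf fV PiE_def extensional_def)
    show "(\<lambda>v\<in>verts H. c (g v)) \<in> colourings A H"
      using c bg gV by (auto simp: colourings_def decreasing_def)
    show "weight q (verts H) (\<lambda>v\<in>verts H. c (g v)) = weight q (verts G) c"
      using sum.reindex_bij_betw[OF g, of c] by (simp add: weight_def)
  next
    fix c assume "c \<in> colourings A H"
    then have c: "c \<in> verts H \<rightarrow>\<^sub>E A" "decreasing H c"
      by (auto simp: colourings_def)
    show "(\<lambda>v\<in>verts H. (\<lambda>v\<in>verts G. c (f v)) (g v)) = c"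
      using c(1) by (auto simp: fun_eq_iff fg gV PiE_def extensional_def)
    show "(\<lambda>v\<in>verts G. c (f v)) \<in> colourings A G"
      using c bf fV by (auto simp: colourings_def decreasing_def)
  qed
qed

text \<open>The sum is the expansion of the product of \<open>(- 1) + 1\<close> over
  \<open>X\<close>, which vanishes unless it is empty.\<close>

lemma sum_Pow_minus_one_power:
  assumes "finite X"
  shows "(\<Sum>L\<in>Pow X. (- 1) ^ card L) = (if X = {} then 1 else 0 :: 'a::comm_ring_1)"
proof -
  have "(\<Prod>i\<in>X. (- 1) + 1 :: 'a) = (\<Sum>L\<in>Pow X. (\<Prod>i\<in>L. - 1) * (\<Prod>i\<in>X - L. 1))"
    using assms by (rule prod_add)
  then show ?thesis
    using assms by (auto simp: power_0_left)
qed

section \<open>Shifting the colours, and inclusion-exclusion over leaves of colour 0\<close>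

context rtree
begin

lemma finite_colourings: "finite A \<Longrightarrow> finite (colourings A G)"
  using finite_PiE[OF finite_V, of "\<lambda>_. A"] by (auto simp: colourings_def)

text \<open>Raising every colour by one keeps the colouring decreasing and contributes one factor
  \<open>q\<close> per vertex.\<close>

lemma colouring_gf_shift:
  "colouring_gf q {Suc 0..Suc n} G = q ^ card V * colouring_gf q {0..n} G"
proof -
  have "colouring_gf q {Suc 0..Suc n} G = (\<Sum>c\<in>colourings {0..n} G. q ^ card V * weight q V c)"
    unfolding colouring_gf_def
  proof (rule sum.reindex_bij_witness[of _ "\<lambda>c. \<lambda>v\<in>V. Suc (c v)" "\<lambda>c. \<lambda>v\<in>V. c v - 1"])
    fix c assume "c \<in> colourings {Suc 0..Suc n} G"
    then have c: "c \<in> V \<rightarrow>\<^sub>E {Suc 0..Suc n}" "decreasing G c"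
      by (auto simp: colourings_def)
    \<comment> \<open>Colours are at least 1 here, so the truncated subtraction loses
      nothing.\<close>
    have pos: "Suc (c v - 1) = c v" if "v \<in> V" for v
      using c(1) that by (auto simp: PiE_def Pi_def)
    show "(\<lambda>v\<in>V. Suc ((\<lambda>v\<in>V. c v - 1) v)) = c"
      using c(1) pos by (auto simp: fun_eq_iff PiE_def extensional_def)
    have "c v - 1 \<in> {0..n}" if "v \<in> V" for v
      using PiE_mem[OF c(1) that] by auto
    moreover have "c v - 1 \<le> c u - 1" if "u \<in> V" "v \<in> V" "below G u v" for u v
      using c(2) that by (auto simp: decreasing_def intro: diff_le_mono)
    ultimately show "(\<lambda>v\<in>V. c v - 1) \<in> colourings {0..n} G"
      by (auto simp: colourings_def decreasing_def)
    have "(\<Sum>v\<in>V. c v) = (\<Sum>v\<in>V. Suc (c v - 1))"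
      using pos by simp
    also have "\<dots> = (\<Sum>v\<in>V. c v - 1) + card V"
      by (simp add: sum_Suc)
    finally show "q ^ card V * weight q V (\<lambda>v\<in>V. c v - 1) = weight q V c"
      by (simp add: weight_def power_add mult.commute)
  next
    fix c assume "c \<in> colourings {0..n} G"
    then have c: "c \<in> V \<rightarrow>\<^sub>E {0..n}" "decreasing G c"
      by (auto simp: colourings_def)
    show "(\<lambda>v\<in>V. (\<lambda>v\<in>V. Suc (c v)) v - 1) = c"
      using c(1) by (auto simp: fun_eq_iff PiE_def extensional_def)
    show "(\<lambda>v\<in>V. Suc (c v)) \<in> colourings {Suc 0..Suc n} G"
      using c by (auto simp: colourings_def decreasing_def)
  qed
  then show ?thesis
    by (simp add: colouring_gf_def sum_distrib_left)
qed

text \<open>A colouring of \<open>U\<close> is extended by 0. As \<open>U\<close> is closed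
  downwards, no vertex outside \<open>U\<close> lies below a vertex of \<open>U\<close>, so the
  extension is still decreasing, and its weight is the same.\<close>

lemma colouring_gf_root_subtree:
  assumes U: "U \<in> root_subtrees G" and A: "0 \<in> A"
  shows "colouring_gf q A (induced G U r) =
    (\<Sum>c\<in>{c \<in> colourings A G. \<forall>v\<in>V - U. c v = 0}. weight q V c)"
proof -
  have UV: "U \<subseteq> V"
    using U by (auto simp: root_subtrees_def)
  have ext: "colourings A (induced G U r) = {c \<in> U \<rightarrow>\<^sub>E A. \<forall>u\<in>U. \<forall>v\<in>U. below G u v \<longrightarrow> c v \<le> c u}"
    using below_root_subtree[OF U] by (auto simp: colourings_def decreasing_def)
  have down: "u \<in> U" if "below G u v" "v \<in> U" for u v
    using root_path_subset[OF U that(2)] below_iff UV that by blast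
  show ?thesis
    unfolding colouring_gf_def ext induced_simps
  proof (rule sum.reindex_bij_witness[of _ "\<lambda>c. restrict c U"
        "\<lambda>c. \<lambda>v\<in>V. if v \<in> U then c v else 0"])
    fix c assume c: "c \<in> {c \<in> U \<rightarrow>\<^sub>E A. \<forall>u\<in>U. \<forall>v\<in>U. below G u v \<longrightarrow> c v \<le> c u}"
    show "restrict (\<lambda>v\<in>V. if v \<in> U then c v else 0) U = c"
      using c UV by (auto simp: fun_eq_iff PiE_def extensional_def)
    show "(\<lambda>v\<in>V. if v \<in> U then c v else 0) \<in> {c \<in> colourings A G. \<forall>v\<in>V - U. c v = 0}"
      using c A down by (auto simp: colourings_def decreasing_def)
    have "(\<Sum>v\<in>V. if v \<in> U then c v else 0) = (\<Sum>v\<in>U. c v)"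
      using UV finite_V by (simp add: sum.If_cases Int_absorb1)
    then show "weight q V (\<lambda>v\<in>V. if v \<in> U then c v else 0) = weight q U c"
      by (simp add: weight_def)
  next
    fix c assume "c \<in> {c \<in> colourings A G. \<forall>v\<in>V - U. c v = 0}"
    then have c: "c \<in> V \<rightarrow>\<^sub>E A" "decreasing G c" "\<forall>v\<in>V - U. c v = 0"
      by (auto simp: colourings_def)
    show "(\<lambda>v\<in>V. if v \<in> U then restrict c U v else 0) = c"
      using c by (auto simp: fun_eq_iff PiE_def extensional_def)
    show "restrict c U \<in> {c \<in> U \<rightarrow>\<^sub>E A. \<forall>u\<in>U. \<forall>v\<in>U. below G u v \<longrightarrow> c v \<le> c u}"
      using c UV by (auto simp: decreasing_def PiE_def Pi_def subset_iff)
  qed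
qed

text \<open>The root is excluded because every root subtree contains it. Thus the one-vertex tree
  has no leaves, which is the source of the additional \<open>\<bullet>\<close> term.\<close>

definition leaves :: "nat set" where
  "leaves = {v \<in> V. v \<noteq> r \<and> (\<forall>w\<in>V. below G v w \<longrightarrow> w = v)}"

lemma finite_leaves: "finite leaves"
  using finite_V by (simp add: leaves_def)

text \<open>A vertex above \<open>v\<close> would give a neighbour of \<open>v\<close> outside
  \<open>U\<close>, and hence a component with at least two elements.\<close>

lemma components_singletons_imp_leaves:
  assumes U: "U \<in> root_subtrees G" and single: "\<forall>C\<in>components_of G (V - U). card C = 1"
  shows "V - U \<subseteq> leaves"
proof
  fix v assume v: "v \<in> V - U"
  have "w = v" if w: "w \<in> V" "below G v w" for w
  proof (rule ccontr)
    assume "w \<noteq> v"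
    obtain a b where ab: "root_path w = a @ v # b"
      using w below_iff by (meson split_list)
    have "a \<noteq> []"
      using root_path(2)[OF w(1)] ab \<open>w \<noteq> v\<close> by (cases a) auto
    \<comment> \<open>\<open>w'\<close> is the child of \<open>v\<close> on the way to
      \<open>w\<close>. It is not in \<open>U\<close>, since its root path passes through
      \<open>v\<close>.\<close>
    then obtain a' w' where a': "a = a' @ [w']"
      by (metis rev_exhaust)
    have path: "is_path G (a' @ w' # v # b)"
      using root_path(1)[OF w(1)] ab a' by simp
    have "is_path G (w' # v # b)"
      using is_path_suffix[OF path] by simp
    then have e: "(w', v) \<in> E" "w' \<noteq> v" "w' \<in> V"
      by (auto simp: is_path_Cons)
    have "root_path w' = w' # v # b"
      using root_path_suffix[OF w(1), of a' "w' # v # b"] ab a' by simp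
    then have "w' \<notin> U"
      using root_path_subset[OF U, of w'] v by auto
    obtain C where C: "C \<in> components_of G (V - U)" "v \<in> C"
      using Union_components[of "V - U"] v by auto
    have "(v, w') \<in> (edges_within G (V - U))\<^sup>*"
      using e v \<open>w' \<notin> U\<close> sym_E by (auto simp: edges_within_def dest: symD)
    then have "w' \<in> C"
      using component_closed[of "V - U" C v w'] C e \<open>w' \<notin> U\<close> by auto
    then show False
      using single C e(2) by (auto simp: card_1_singleton_iff)
  qed
  moreover have "v \<noteq> r"
    using U v by (auto simp: root_subtrees_def)
  ultimately show "v \<in> leaves"
    using v by (auto simp: leaves_def)
qed

text \<open>No leaf lies properly below another vertex, so the remaining root paths survive the cut.
  Adjacent vertices are comparable, so two leaves are never adjacent and all components of
  \<open>L\<close> are singletons.\<close>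

lemma remove_leaves:
  assumes L: "L \<subseteq> leaves"
  shows "V - L \<in> root_subtrees G" "\<forall>C\<in>components_of G L. card C = 1"
proof -
  have sub: "set (root_path v) \<subseteq> V - L" if "v \<in> V - L" for v
  proof
    fix u assume u: "u \<in> set (root_path v)"
    then have "below G u v" "u \<in> V"
      using that below_iff root_path(1)[of v] by (auto simp: is_path_def)
    then show "u \<in> V - L"
      using L that by (auto simp: leaves_def)
  qed
  have to_root: "(v, r) \<in> (edges_within G (V - L))\<^sup>*" if "v \<in> V - L" for v
    using is_path_rtrancl[of G "root_path v", OF _ sub[OF that]] root_path that by auto
  have "sym ((edges_within G (V - L))\<^sup>*)"
    using sym_E by (intro sym_rtrancl) (auto simp: edges_within_def sym_def)
  then have "(u, v) \<in> (edges_within G (V - L))\<^sup>*" if "u \<in> V - L" "v \<in> V - L" for u v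
    using to_root[OF that(1)] to_root[OF that(2)] by (meson rtrancl_trans symD)
  moreover have "r \<in> V - L"
    using L root_in_V by (auto simp: leaves_def)
  ultimately show "V - L \<in> root_subtrees G"
    by (auto simp: root_subtrees_def connected_set_def)
  have LV: "L \<subseteq> V"
    using L by (auto simp: leaves_def)
  have "(u, v) \<notin> edges_within G L" for u v
  proof
    assume "(u, v) \<in> edges_within G L"
    then have uv: "(u, v) \<in> E" "u \<in> leaves" "v \<in> leaves"
      using L by (auto simp: edges_within_def)
    then have "u = v"
      using edge_below[OF uv(1)] by (auto simp: leaves_def)
    then show False
      using uv(1) irrefl_E by (auto simp: irrefl_def)
  qed
  then have empty: "edges_within G L = {}"
    by auto
  show "\<forall>C\<in>components_of G L. card C = 1"
    by (auto simp: components_of_def empty quotient_def Image_def card_1_singleton_iff)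
qed

text \<open>This is the product over components in \<open>Crls\<diamond>(A, -\<bullet>)\<close>:
  each singleton gives \<open>- 1\<close>, any larger component gives 0.\<close>

lemma prod_singleton_components:
  assumes W: "W \<subseteq> V"
  shows "(\<Prod>C\<in>components_of G W. - (if card C = 1 then 1 else 0)) =
    (if \<forall>C\<in>components_of G W. card C = 1 then (- 1) ^ card W else 0 :: 'a::comm_ring_1)"
proof (cases "\<forall>C\<in>components_of G W. card C = 1")
  case True
  have "card W = (\<Sum>C\<in>components_of G W. card C)"
    using card_Union_disjoint[of "components_of G W"] Union_components[OF W]
      components_disjoint[OF W] component_subset[OF W] W finite_V
    by (metis disjnt_def finite_subset pairwiseI)
  also have "\<dots> = card (components_of G W)"
    using True by simp
  finally show ?thesis
    using True by simp
next
  case False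
  then obtain C where C: "C \<in> components_of G W" "card C \<noteq> 1"
    by auto
  have "(\<Prod>C\<in>components_of G W. - (if card C = 1 then 1 else 0)) = (0 :: 'a)"
    using C finite_components[OF W] by (intro prod_zero) auto
  then show ?thesis
    unfolding if_not_P[OF False] .
qed

text \<open>Each \<open>U\<close> with singleton complementary components is obtained by cutting off a set of leaves,
  so the sum is an inclusion-exclusion over the leaves of colour \<open>0\<close>.\<close>

lemma sum_root_subtrees_colouring_gf:
  assumes A: "0 \<in> A" "finite A"
  shows "(\<Sum>U\<in>root_subtrees G. colouring_gf q A (induced G U r) *
      (\<Prod>C\<in>components_of G (V - U). - (if card C = 1 then 1 else 0))) =
    (\<Sum>c\<in>{c \<in> colourings A G. \<forall>v\<in>leaves. c v \<noteq> 0}. weight q V c)" (is "?lhs = ?rhs")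
proof -
  let ?S = "{U \<in> root_subtrees G. \<forall>C\<in>components_of G (V - U). card C = 1}"
  have fin: "finite (colourings A G)"
    using finite_colourings A by simp
  have "?lhs = (\<Sum>U\<in>root_subtrees G. colouring_gf q A (induced G U r) *
      (if \<forall>C\<in>components_of G (V - U). card C = 1 then (- 1) ^ card (V - U) else 0))"
    by (subst prod_singleton_components) auto
  also have "\<dots> = (\<Sum>U\<in>?S. colouring_gf q A (induced G U r) * (- 1) ^ card (V - U))"
    using finite_root_subtrees by (intro sum.mono_neutral_cong_right) auto
  also have "\<dots> = (\<Sum>L\<in>Pow leaves. colouring_gf q A (induced G (V - L) r) * (- 1) ^ card L)"
  proof (rule sum.reindex_bij_witness[of _ "\<lambda>L. V - L" "\<lambda>U. V - U"])
    fix U assume "U \<in> ?S"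
    then show "V - (V - U) = U" "V - U \<in> Pow leaves"
      using components_singletons_imp_leaves by (auto simp: root_subtrees_def)
    then show "colouring_gf q A (induced G (V - (V - U)) r) * (- 1) ^ card (V - U) =
        colouring_gf q A (induced G U r) * (- 1) ^ card (V - U)"
      by simp
  next
    fix L assume L: "L \<in> Pow leaves"
    then show LV: "V - (V - L) = L"
      by (auto simp: leaves_def)
    show "V - L \<in> ?S"
      using remove_leaves[of L] L LV by simp
  qed
  also have "\<dots> = (\<Sum>L\<in>Pow leaves. \<Sum>c\<in>{c \<in> colourings A G. \<forall>v\<in>L. c v = 0}.
      weight q V c * (- 1) ^ card L)"
  proof (rule sum.cong[OF refl])
    fix L assume L: "L \<in> Pow leaves"
    then have "V - (V - L) = L"
      by (auto simp: leaves_def)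
    then show "colouring_gf q A (induced G (V - L) r) * (- 1) ^ card L =
        (\<Sum>c\<in>{c \<in> colourings A G. \<forall>v\<in>L. c v = 0}. weight q V c * (- 1) ^ card L)"
      using colouring_gf_root_subtree[of "V - L" A q] remove_leaves(1)[of L] L A
      by (simp add: sum_distrib_right)
  qed
  also have "\<dots> = (\<Sum>c\<in>colourings A G. \<Sum>L\<in>{L \<in> Pow leaves. \<forall>v\<in>L. c v = 0}.
      weight q V c * (- 1) ^ card L)"
    using fin finite_leaves by (intro sum.swap_restrict) auto
  also have "\<dots> = (\<Sum>c\<in>colourings A G. if \<forall>v\<in>leaves. c v \<noteq> 0 then weight q V c else 0)"
  proof (rule sum.cong[OF refl])
    fix c :: "nat \<Rightarrow> nat"
    \<comment> \<open>For a fixed colouring, \<open>L\<close> ranges over all sets of leaves of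
      colour 0, so the signs cancel unless there is no such leaf.\<close>
    have *: "{L \<in> Pow leaves. \<forall>v\<in>L. c v = 0} = Pow {v \<in> leaves. c v = 0}"
      by auto
    have "(\<Sum>L\<in>{L \<in> Pow leaves. \<forall>v\<in>L. c v = 0}. weight q V c * (- 1) ^ card L) =
        weight q V c * (if {v \<in> leaves. c v = 0} = {} then 1 else 0)"
      unfolding * sum_distrib_left[symmetric]
      using finite_leaves by (subst sum_Pow_minus_one_power) auto
    then show "(\<Sum>L\<in>{L \<in> Pow leaves. \<forall>v\<in>L. c v = 0}. weight q V c * (- 1) ^ card L) =
        (if \<forall>v\<in>leaves. c v \<noteq> 0 then weight q V c else 0)"
      by auto
  qed
  also have "\<dots> = ?rhs"
    using fin by (simp add: sum.inter_filter)
  finally show ?thesis .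
qed

text \<open>Colours do not grow away from the root, so with at least two vertices a vertex of colour
  0 forces a leaf of colour 0. For a single vertex, which is not a leaf, the zero colouring survives
  with weight 1.\<close>

lemma colouring_gf_no_zero_leaf:
  "(\<Sum>c\<in>{c \<in> colourings {0..n} G. \<forall>v\<in>leaves. c v \<noteq> 0}. weight q V c) =
    colouring_gf q {1..n} G + (if card V = 1 then 1 else 0)"
proof (cases "card V = 1")
  case True
  then have V: "V = {r}"
    using root_in_V by (auto simp: card_1_singleton_iff)
  let ?z = "\<lambda>v\<in>V. 0 :: nat"
  have "{c \<in> colourings {0..n} G. \<forall>v\<in>leaves. c v \<noteq> 0} = insert ?z (colourings {1..n} G)"
  proof (intro equalityI subsetI)
    fix c assume "c \<in> {c \<in> colourings {0..n} G. \<forall>v\<in>leaves. c v \<noteq> 0}"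
    then have c: "c \<in> V \<rightarrow>\<^sub>E {0..n}" "decreasing G c"
      by (auto simp: colourings_def)
    show "c \<in> insert ?z (colourings {1..n} G)"
    proof (cases "c r = 0")
      case True
      then have "c = ?z"
        using c(1) V by (auto simp: fun_eq_iff PiE_def extensional_def)
      then show ?thesis by simp
    next
      case False
      then show ?thesis
        using c V by (auto simp: colourings_def PiE_def Pi_def)
    qed
  next
    fix c assume "c \<in> insert ?z (colourings {1..n} G)"
    then show "c \<in> {c \<in> colourings {0..n} G. \<forall>v\<in>leaves. c v \<noteq> 0}"
      using V by (auto simp: colourings_def leaves_def decreasing_def PiE_def Pi_def)
  qed
  moreover have "?z \<notin> colourings {1..n} G"
    using V by (auto simp: colourings_def PiE_def Pi_def)
  moreover have "weight q V ?z = 1"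
    by (simp add: weight_def)
  ultimately show ?thesis
    using True finite_colourings by (simp add: colouring_gf_def add.commute)
next
  case False
  have pos: "c v \<noteq> 0"
    if c: "c \<in> colourings {0..n} G" "\<forall>v\<in>leaves. c v \<noteq> 0" and v: "v \<in> V" for c v
  proof
    assume "c v = 0"
    let ?Z = "{w \<in> V. c w = 0}"
    have Z: "finite ?Z" "?Z \<noteq> {}"
      using finite_V v \<open>c v = 0\<close> by auto
    \<comment> \<open>A vertex of colour 0 of greatest depth: anything above it would again have
      colour 0 and be deeper.\<close>
    then obtain w where w: "w \<in> ?Z"
      "length (root_path w) = Max ((\<lambda>w. length (root_path w)) ` ?Z)"
      by (metis (mono_tags, lifting) obtains_MAX)
    have top: "x = w" if x: "x \<in> V" "below G w x" for x
    proof (rule ccontr)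
      assume "x \<noteq> w"
      then have less: "length (root_path w) < length (root_path x)"
        using length_root_path_less x below_iff by auto
      have "c x \<le> c w"
        using c(1) w x by (auto simp: colourings_def decreasing_def)
      then have "x \<in> ?Z"
        using w x by simp
      then have "length (root_path x) \<le> Max ((\<lambda>w. length (root_path w)) ` ?Z)"
        using Z(1) by (intro Max_ge) auto
      then show False
        using less w by simp
    qed
    show False
    proof (cases "w = r")
      case True
      then have "x = r" if "x \<in> V" for x
        using top[OF that] below_root[OF that] by simp
      then have "V = {r}"
        using root_in_V by blast
      then show False
        using False by simp
    next
      case False
      then have "w \<in> leaves"
        unfolding leaves_def using top w(1) by blast
      then show False
        using c(2) w(1) by blast
    qed
  qed
  have "{c \<in> colourings {0..n} G. \<forall>v\<in>leaves. c v \<noteq> 0} = colourings {1..n} G"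
  proof (intro equalityI subsetI)
    fix c assume c: "c \<in> {c \<in> colourings {0..n} G. \<forall>v\<in>leaves. c v \<noteq> 0}"
    then have "c \<in> V \<rightarrow>\<^sub>E {0..n}" "decreasing G c" "\<And>v. v \<in> V \<Longrightarrow> c v \<noteq> 0"
      using pos[of c] by (auto simp: colourings_def)
    then show "c \<in> colourings {1..n} G"
      by (auto simp: colourings_def PiE_def Pi_def Suc_le_eq)
  next
    fix c assume c: "c \<in> colourings {1..n} G"
    then have "c \<in> V \<rightarrow>\<^sub>E {1..n}" "decreasing G c"
      by (auto simp: colourings_def)
    moreover have "c v \<noteq> 0" if "v \<in> leaves" for v
      using PiE_mem[OF calculation(1), of v] that by (auto simp: leaves_def)
    ultimately show "c \<in> {c \<in> colourings {0..n} G. \<forall>v\<in>leaves. c v \<noteq> 0}"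
      by (auto simp: colourings_def PiE_def Pi_def)
  qed
  then show ?thesis
    using False by (simp add: colouring_gf_def)
qed

section \<open>Colourings whose root has the largest colour\<close>

lemma colouring_gf_diff:
  "colouring_gf q {1..Suc n} G - colouring_gf q {1..n} G =
    (\<Sum>c\<in>{c \<in> colourings {1..Suc n} G. c r = Suc n}. weight q V c)"
proof -
  have max: "c v \<le> c r" if "c \<in> colourings A G" "v \<in> V" for c v A
    using that below_root root_in_V by (auto simp: colourings_def decreasing_def)
  \<comment> \<open>The root carries the largest value of a decreasing colouring, so
    \<open>Suc n\<close> occurs only if the root has it.\<close>
  have "colourings {1..n} G = {c \<in> colourings {1..Suc n} G. c r \<noteq> Suc n}"
  proof (intro equalityI subsetI)
    fix c assume "c \<in> colourings {1..n} G"
    then show "c \<in> {c \<in> colourings {1..Suc n} G. c r \<noteq> Suc n}"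
      using root_in_V by (fastforce simp: colourings_def PiE_def Pi_def)
  next
    fix c assume c: "c \<in> {c \<in> colourings {1..Suc n} G. c r \<noteq> Suc n}"
    then have "c r \<le> n"
      using root_in_V by (fastforce simp: colourings_def PiE_def Pi_def)
    then have "c v \<le> n" if "v \<in> V" for v
      using max[of c _ v] c that by fastforce
    then show "c \<in> colourings {1..n} G"
      using c by (auto simp: colourings_def PiE_def Pi_def)
  qed
  moreover have "colourings {1..Suc n} G = {c \<in> colourings {1..Suc n} G. c r = Suc n} \<union>
      {c \<in> colourings {1..Suc n} G. c r \<noteq> Suc n}"
    by auto
  moreover have "(\<Sum>c\<in>{c \<in> colourings {1..Suc n} G. c r = Suc n} \<union>
        {c \<in> colourings {1..Suc n} G. c r \<noteq> Suc n}. weight q V c) =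
      (\<Sum>c\<in>{c \<in> colourings {1..Suc n} G. c r = Suc n}. weight q V c) +
      (\<Sum>c\<in>{c \<in> colourings {1..Suc n} G. c r \<noteq> Suc n}. weight q V c)"
    using finite_colourings by (intro sum.union_disjoint) auto
  ultimately show ?thesis
    unfolding colouring_gf_def by simp
qed

text \<open>The last vertex before \<open>r\<close> on a root path starting in \<open>C\<close> lies
  in \<open>C\<close> and has distance at most 1. The minimal distance is therefore at most 1, and
  it is not 0 because \<open>r\<close> is not in \<open>C\<close>.\<close>

lemma closest_to_root_adjacent:
  assumes C: "C \<in> components_of G (V - {r})"
  shows "(closest_to_root G C, r) \<in> E"
proof -
  let ?d = "graph_dist G r" and ?s = "closest_to_root G C"
  have sub: "C \<subseteq> V - {r}"
    using component_subset[OF _ C] by simp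
  obtain v where v: "v \<in> C"
    using component_nonempty[OF _ C] by auto
  then have vV: "v \<in> V" "v \<noteq> r"
    using sub by auto
  obtain p where p: "root_path v = p @ [r]"
    using root_path(3,4)[OF vV(1)] by (metis append_butlast_last_id)
  have path: "is_path G (p @ [r])"
    using root_path(1)[OF vV(1)] p by simp
  have ne: "p \<noteq> []"
    using root_path(2)[OF vV(1)] p vV by (cases p) auto
  have hd: "hd p = v"
    using root_path(2)[OF vV(1)] p ne by simp
  have pG: "is_path G p" "set p \<subseteq> V - {r}" "(last p, r) \<in> E"
    using is_path_prefix[OF path ne] path ne by (auto simp: is_path_def successively_append_iff)
  have "last p \<in> C"
    using component_closed[OF _ C v, of "last p"] is_path_rtrancl[OF pG(1,2)] hd pG(2) ne
    by (auto simp: subset_iff)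
  have "(r, last p) \<in> E ^^ 1"
    using pG(3) sym_E by (auto dest: symD)
  then have "?d (last p) \<le> 1"
    unfolding graph_dist_def by (rule Least_le)
  then have le: "?d ?s \<le> 1"
    using arg_min_nat_le[of "\<lambda>v. v \<in> C" "last p" ?d] \<open>last p \<in> C\<close>
    unfolding closest_to_root_def by linarith
  have sC: "?s \<in> V" "?s \<noteq> r"
    using closest_to_root_in[OF _ C] sub by auto
  have "(r, ?s) \<in> (edges_within G V)\<^sup>*"
    using connected_V root_in_V sC by (auto simp: connected_set_def)
  then have "(r, ?s) \<in> E\<^sup>*"
    by (rule rtrancl_mono[THEN subsetD, rotated]) (auto simp: edges_within_def)
  then have "(r, ?s) \<in> E ^^ ?d ?s"
    unfolding graph_dist_def rtrancl_power by (rule LeastI_ex)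
  moreover have "?d ?s = 0 \<or> ?d ?s = 1"
    using le by auto
  ultimately have "(r, ?s) \<in> E"
    using sC by auto
  then show ?thesis
    using sym_E by (auto dest: symD)
qed

text \<open>A path inside \<open>C\<close> to its root, followed by \<open>r\<close>, is the root
  path in \<open>G\<close>. So the order of the component is the restriction of the order of
  \<open>G\<close>.\<close>

lemma below_component:
  assumes C: "C \<in> components_of G (V - {r})" and v: "v \<in> C"
  shows "below (induced G C (closest_to_root G C)) u v \<longleftrightarrow> u \<noteq> r \<and> below G u v"
    and "u \<noteq> r \<Longrightarrow> below G u v \<Longrightarrow> u \<in> C"
proof -
  let ?s = "closest_to_root G C"
  have sub: "C \<subseteq> V - {r}"
    using component_subset[OF _ C] by simp
  then have CV: "C \<subseteq> V"
    by auto
  obtain p where p: "is_path G p" "hd p = v" "last p = ?s" "set p \<subseteq> C"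
    using connected_set_path[OF component_connected[OF _ C] CV v closest_to_root_in[OF _ C]] by auto
  have "p \<noteq> []"
    using p(1) by (auto simp: is_path_def)
  then have "is_path G (p @ [r])"
    using p sub root_in_V closest_to_root_adjacent[OF C]
    by (auto simp: is_path_def successively_append_iff)
  then have rp: "root_path v = p @ [r]"
    using root_path_eqI[of "p @ [r]"] p(2) \<open>p \<noteq> []\<close> by simp
  have "r \<notin> set p"
    using p(4) sub by auto
  then have *: "u \<noteq> r \<and> below G u v \<longleftrightarrow> u \<in> set p"
    using below_iff[of v u] CV v rp by auto
  then show "u \<noteq> r \<Longrightarrow> below G u v \<Longrightarrow> u \<in> C"
    using p(4) by auto
  show "below (induced G C ?s) u v \<longleftrightarrow> u \<noteq> r \<and> below G u v"
    unfolding * below_induced[OF CV] using p path_unique by metis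
qed

text \<open>A colouring whose root has the largest colour restricts to independent colourings of the
  components of the complement of the root.\<close>

lemma sum_colourings_root_max:
  assumes A: "finite A" "m \<in> A" "\<And>a. a \<in> A \<Longrightarrow> a \<le> m"
  shows "(\<Sum>c\<in>{c \<in> colourings A G. c r = m}. weight q V c) =
    q ^ m * (\<Prod>C\<in>components_of G (V - {r}).
      colouring_gf q A (induced G C (closest_to_root G C)))"
proof -
  let ?K = "components_of G (V - {r})"
  let ?H = "\<lambda>C. induced G C (closest_to_root G C)"
  let ?comp = "\<lambda>v. THE C. C \<in> ?K \<and> v \<in> C"
  have finK: "finite ?K"
    by (simp add: finite_components)
  have sub: "C \<subseteq> V - {r}" if "C \<in> ?K" for C
    using component_subset[OF _ that] by simp
  have finC: "finite C" if "C \<in> ?K" for C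
    using sub[OF that] finite_V by (meson finite_Diff finite_subset)
  have comp_eq: "?comp v = C" if "C \<in> ?K" "v \<in> C" for v C
    using that components_disjoint[of "V - {r}"] by (intro the_equality) blast+
  have ex: "\<exists>C\<in>?K. v \<in> C" if "v \<in> V" "v \<noteq> r" for v
    using Union_components[of "V - {r}"] that by auto
  have K: "colourings A (?H C) =
      {c \<in> C \<rightarrow>\<^sub>E A. \<forall>u\<in>C. \<forall>v\<in>C. below G u v \<longrightarrow> c v \<le> c u}" if "C \<in> ?K" for C
  proof -
    have "below (?H C) u v \<longleftrightarrow> below G u v" if "u \<in> C" "v \<in> C" for u v
      using below_component(1)[OF \<open>C \<in> ?K\<close> that(2)] sub[OF \<open>C \<in> ?K\<close>] that(1) by auto
    then show ?thesis
      by (auto simp: colourings_def decreasing_def)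
  qed
  have fin: "finite (colourings A (?H C))" if "C \<in> ?K" for C
    using finC[OF that] A(1) finite_PiE[of C "\<lambda>_. A"] by (simp add: K[OF that])
  let ?P = "Pi\<^sub>E ?K (\<lambda>C. colourings A (?H C))"
  \<comment> \<open>Inverse of restriction: the root gets \<open>m\<close>, every other vertex is
    coloured by the colouring of its own component.\<close>
  let ?glue = "\<lambda>g. \<lambda>v\<in>V. if v = r then m else g (?comp v) v"
  have glue: "?glue g v = g C v" if "C \<in> ?K" "v \<in> C" for g C v
    using that sub[OF that(1)] comp_eq[OF that] by auto
  have "(\<Sum>c\<in>{c \<in> colourings A G. c r = m}. weight q V c) =
      (\<Sum>g\<in>?P. q ^ m * (\<Prod>C\<in>?K. weight q C (g C)))"
  proof (rule sum.reindex_bij_witness[of _ ?glue "\<lambda>c. \<lambda>C\<in>?K. restrict c C"])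
    fix c assume "c \<in> {c \<in> colourings A G. c r = m}"
    then have c: "c \<in> V \<rightarrow>\<^sub>E A" "decreasing G c" "c r = m"
      by (auto simp: colourings_def)
    show "?glue (\<lambda>C\<in>?K. restrict c C) = c"
    proof
      fix v
      consider "v \<notin> V" | "v = r" | C where "C \<in> ?K" "v \<in> C"
        using ex by blast
      then show "?glue (\<lambda>C\<in>?K. restrict c C) v = c v"
      proof cases
        case 1
        then show ?thesis using c(1) by (simp add: PiE_def extensional_def)
      next
        case 2
        then show ?thesis using c(3) root_in_V by simp
      next
        case 3
        then show ?thesis by (simp only: glue) simp
      qed
    qed
    show "(\<lambda>C\<in>?K. restrict c C) \<in> ?P"
    proof (rule restrict_PiE_iff[THEN iffD2], rule ballI)
      fix C assume C: "C \<in> ?K"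
      show "restrict c C \<in> colourings A (?H C)"
        using c sub[OF C] unfolding K[OF C]
        by (auto simp: decreasing_def PiE_def Pi_def subset_iff)
    qed
    have "(\<Sum>v\<in>V. c v) = m + (\<Sum>v\<in>V - {r}. c v)"
      using c(3) finite_V root_in_V by (simp add: sum.remove)
    also have "(\<Sum>v\<in>V - {r}. c v) = (\<Sum>C\<in>?K. \<Sum>v\<in>C. c v)"
      using sum.Union_disjoint[of ?K c] finC components_disjoint[of "V - {r}"]
        Union_components[of "V - {r}"] by auto
    finally show "q ^ m * (\<Prod>C\<in>?K. weight q C ((\<lambda>C\<in>?K. restrict c C) C)) = weight q V c"
      by (simp add: weight_def power_add power_sum)
  next
    fix g assume g: "g \<in> ?P"
    have gC: "g C \<in> C \<rightarrow>\<^sub>E A" "\<And>u v. u \<in> C \<Longrightarrow> v \<in> C \<Longrightarrow> below G u v \<Longrightarrow> g C v \<le> g C u"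
      if "C \<in> ?K" for C
      using PiE_mem[OF g that] unfolding K[OF that] by auto
    show "(\<lambda>C\<in>?K. restrict (?glue g) C) = g"
    proof
      fix C
      show "(\<lambda>C\<in>?K. restrict (?glue g) C) C = g C"
      proof (cases "C \<in> ?K")
        case True
        have "restrict (?glue g) C = g C"
        proof
          fix v
          show "restrict (?glue g) C v = g C v"
            using gC(1)[OF True] glue[OF True, of v g]
            by (cases "v \<in> C") (auto simp: PiE_def extensional_def)
        qed
        then show ?thesis using True by simp
      next
        case False
        then show ?thesis using g by (auto simp: PiE_def extensional_def)
      qed
    qed
    have mem: "?glue g v \<in> A" if v: "v \<in> V" for v
    proof (cases "v = r")
      case True
      then show ?thesis using A v by simp
    next
      case False
      then obtain C where C: "C \<in> ?K" "v \<in> C"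
        using ex v by blast
      show ?thesis
        unfolding glue[OF C] using PiE_mem[OF gC(1)[OF C(1)] C(2)] .
    qed
    \<comment> \<open>Either \<open>u\<close> is the root, whose colour \<open>m\<close> is maximal,
      or \<open>u\<close> and \<open>v\<close> lie in the same component.\<close>
    have "?glue g v \<le> ?glue g u" if uv: "u \<in> V" "v \<in> V" "below G u v" for u v
    proof (cases "u = r")
      case True
      then have "?glue g u = m"
        using uv by simp
      then show ?thesis
        using A(3)[OF mem[OF uv(2)]] by linarith
    next
      case False
      have "v \<noteq> r"
        using False uv(3) below_iff[OF root_in_V] by (auto simp: root_path_root)
      then obtain C where C: "C \<in> ?K" "v \<in> C"
        using ex uv by blast
      have u: "u \<in> C"
        using below_component(2)[OF C False uv(3)] .
      show ?thesis
        unfolding glue[OF C] glue[OF C(1) u] using gC(2)[OF C(1) u C(2) uv(3)] .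
    qed
    then have "decreasing G (?glue g)"
      unfolding decreasing_def by blast
    moreover have "?glue g \<in> V \<rightarrow>\<^sub>E A"
      using mem by (intro PiE_I) auto
    moreover have "?glue g r = m"
      using root_in_V by simp
    ultimately show "?glue g \<in> {c \<in> colourings A G. c r = m}"
      by (simp add: colourings_def)
  qed
  also have "\<dots> = q ^ m * (\<Prod>C\<in>?K. colouring_gf q A (?H C))"
    unfolding colouring_gf_def induced_simps using fin finK
    by (subst prod_sum_PiE) (auto simp: sum_distrib_left)
  finally show ?thesis .
qed

end

section \<open>The functional equation\<close>

text \<open>Here \<open>w\<close> stands for \<open>1 + (q - 1) x\<close>. With the ring and
  \<open>w\<close> left open, the same equation covers the polynomial setting and its
  evaluations.\<close>

definition tree_equation :: "'a::comm_ring_1 \<Rightarrow> 'a \<Rightarrow> 'a tree_series \<Rightarrow> bool" where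
  "tree_equation q w A \<longleftrightarrow>
     (\<forall>T. q * suspension q A T - crls A (\<lambda>T'. - bullet T') T =
        q * w * crls bullet (\<lambda>T'. q * suspension q A T') T - bullet T)"

lemma S_equation_iff: "S_equation A \<longleftrightarrow> tree_equation qx (1 + (qx - 1) * xvar) A"
  by (simp add: S_equation_def tree_equation_def fun_eq_iff)

text \<open>The root subtree \<open>V\<close> leaves an empty complement and contributes exactly
  \<open>A T\<close>; every other root subtree has fewer vertices than \<open>T\<close>.\<close>

lemma crls_cong_left:
  assumes "\<And>T'. num_verts T' < num_verts T \<Longrightarrow> A T' = A' T'"
  shows "crls A B T - A T = crls A' B T - A' T"
proof -
  interpret rtree "rep_tree T"
    by unfold_locales (rule rooted_tree_rep_tree)
  let ?f = "\<lambda>A U. A (tree_class (induced (rep_tree T) U r)) *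
    (\<Prod>C\<in>components_of (rep_tree T) (V - U).
       B (tree_class (induced (rep_tree T) C (closest_to_root (rep_tree T) C))))"
  have split: "crls A B T - A T = (\<Sum>U\<in>root_subtrees (rep_tree T) - {V}. ?f A U)" for A
  proof -
    have "?f A V = A T"
      by (simp add: components_of_def quotient_def tree_class_induced_V tree_class_rep_tree)
    then show ?thesis
      unfolding crls_def crls_graph_def
      by (subst sum.remove[OF finite_root_subtrees V_root_subtree]) simp
  qed
  have "?f A U = ?f A' U" if U: "U \<in> root_subtrees (rep_tree T) - {V}" for U
  proof -
    have "U \<subset> V"
      using U by (auto simp: root_subtrees_def)
    then have "num_verts (tree_class (induced (rep_tree T) U r)) < num_verts T"
      using U psubset_card_mono[OF finite_V]
      by (simp add: num_verts_tree_class rooted_tree_root_subtree num_verts_def[of T])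
    then show ?thesis
      using assms by simp
  qed
  then show ?thesis
    unfolding split by (intro sum.cong) auto
qed

text \<open>The components avoid the root, so each has fewer vertices than \<open>T\<close>.\<close>

lemma crls_cong_right:
  assumes "\<And>T'. num_verts T' < num_verts T \<Longrightarrow> B T' = B' T'"
  shows "crls A B T = crls A B' T"
proof -
  interpret rtree "rep_tree T"
    by unfold_locales (rule rooted_tree_rep_tree)
  have "B (tree_class (induced (rep_tree T) C (closest_to_root (rep_tree T) C))) =
      B' (tree_class (induced (rep_tree T) C (closest_to_root (rep_tree T) C)))"
    if U: "U \<in> root_subtrees (rep_tree T)" and C: "C \<in> components_of (rep_tree T) (V - U)" for U C
  proof -
    have "C \<subset> V"
      using U component_subset[OF _ C] by (auto simp: root_subtrees_def)
    then have "card C < num_verts T"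
      using psubset_card_mono[OF finite_V] by (simp add: num_verts_def)
    then show ?thesis
      using assms rooted_tree_component[OF _ C] by (simp add: num_verts_tree_class)
  qed
  then show ?thesis
    unfolding crls_def crls_graph_def by (intro sum.cong arg_cong2[of _ _ _ _ times] prod.cong) auto
qed

section \<open>Recursion on the number of vertices: uniqueness and existence\<close>

definition lower_terms :: "'a::comm_ring_1 \<Rightarrow> 'a \<Rightarrow> 'a tree_series \<Rightarrow> 'a tree_series" where
  "lower_terms q w A T = q * w * crls bullet (\<lambda>T'. q * suspension q A T') T - bullet T +
     (crls A (\<lambda>T'. - bullet T') T - A T)"

lemma lower_terms_cong:
  assumes "\<And>T'. num_verts T' < num_verts T \<Longrightarrow> A T' = A' T'"
  shows "lower_terms q w A T = lower_terms q w A' T"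
proof -
  have "crls bullet (\<lambda>T'. q * suspension q A T') T = crls bullet (\<lambda>T'. q * suspension q A' T') T"
    using assms by (intro crls_cong_right) (simp add: suspension_def)
  moreover have "crls A (\<lambda>T'. - bullet T') T - A T = crls A' (\<lambda>T'. - bullet T') T - A' T"
    using assms by (intro crls_cong_left) simp
  ultimately show ?thesis
    by (simp add: lower_terms_def)
qed

lemma mult_suspension: "q * suspension q A T = q ^ num_verts T * A T"
  using num_verts_pos[of T] by (simp add: suspension_def power_eq_if[of q "num_verts T"] mult.assoc)

text \<open>The coefficient \<open>A T\<close> occurs once in \<open>q \<Sigma>\<^sub>q A\<close>,
  with factor \<open>q ^ num_verts T\<close>, and once in
  \<open>Crls\<diamond>(A, -\<bullet>)\<close>, with factor 1. Collecting both leaves terms from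
  smaller trees only.\<close>

lemma tree_equation_iff:
  "tree_equation q w A \<longleftrightarrow> (\<forall>T. (q ^ num_verts T - 1) * A T = lower_terms q w A T)"
proof -
  have "a * x - c = y - b \<longleftrightarrow> (a - 1) * x = y - b + (c - x)" for a b c x y :: 'a
    by (auto simp: algebra_simps)
  then show ?thesis
    unfolding tree_equation_def lower_terms_def mult_suspension[of q A] by simp
qed

lemma tree_equation_unique:
  fixes q w :: "'a::idom"
  assumes q: "\<And>k. k > 0 \<Longrightarrow> q ^ k \<noteq> 1"
    and eq: "tree_equation q w A" "tree_equation q w A'"
  shows "A = A'"
proof
  fix T
  show "A T = A' T"
  proof (induction T rule: measure_induct_rule[of num_verts])
    case (less T)
    then have "lower_terms q w A T = lower_terms q w A' T"
      by (rule lower_terms_cong)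
    then have "(q ^ num_verts T - 1) * A T = (q ^ num_verts T - 1) * A' T"
      using eq by (simp add: tree_equation_iff)
    then show ?case
      using q[OF num_verts_pos[of T]] by simp
  qed
qed

text \<open>\<open>u k\<close> is an inverse of \<open>q ^ k - 1\<close>, so the recursion can be
  solved in a ring that is not a field, such as a polynomial ring.\<close>

lemma tree_equation_exists:
  fixes q w :: "'a::comm_ring_1"
  assumes u: "\<And>k. k > 0 \<Longrightarrow> (q ^ k - 1) * u k = 1"
  shows "\<exists>A. tree_equation q w A"
proof -
  define A where "A = wfrec (measure num_verts) (\<lambda>f T. u (num_verts T) * lower_terms q w f T)"
  have "A T = u (num_verts T) * lower_terms q w A T" for T
  proof -
    have "A T = u (num_verts T) * lower_terms q w (cut A (measure num_verts) T) T"
      unfolding A_def by (subst wfrec) simp_all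
    \<comment> \<open>The cut function agrees with \<open>A\<close> on smaller trees, the only ones
      on which \<open>lower_terms\<close> depends.\<close>
    also have "lower_terms q w (cut A (measure num_verts) T) T = lower_terms q w A T"
      by (rule lower_terms_cong) (simp add: cut_apply)
    finally show ?thesis .
  qed
  then have "(q ^ num_verts T - 1) * A T = lower_terms q w A T" for T
    using u[OF num_verts_pos[of T]] by (metis mult.assoc mult_1)
  then show ?thesis
    by (auto simp: tree_equation_iff)
qed

text \<open>Evaluation at \<open>a\<close> is a ring homomorphism and commutes with the finite sums
  and products in the equation.\<close>

lemma tree_equation_poly:
  assumes "tree_equation q w A"
  shows "tree_equation (poly q a) (poly w a) (\<lambda>T. poly (A T) a)"
proof -
  have crls: "poly (crls A B T) a = crls (\<lambda>T. poly (A T) a) (\<lambda>T. poly (B T) a) T" for A B T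
    by (simp add: crls_def crls_graph_def poly_sum poly_prod)
  have bullet: "poly (bullet T) a = bullet T" for T
    by (simp add: bullet_def)
  have susp: "poly (suspension q A T) a = suspension (poly q a) (\<lambda>T. poly (A T) a) T" for A T
    by (simp add: suspension_def)
  have "poly (q * suspension q A T - crls A (\<lambda>T'. - bullet T') T) a =
      poly (q * w * crls bullet (\<lambda>T'. q * suspension q A T') T - bullet T) a" for T
    using assms by (simp add: tree_equation_def)
  then show ?thesis
    unfolding tree_equation_def by (simp add: crls bullet susp)
qed

section \<open>The colouring series solves the evaluated equation\<close>

lemma (in rtree) root_singleton_subtree: "{r} \<in> root_subtrees G"
  by (auto simp: root_subtrees_def connected_set_def root_in_V)

lemma tree_equation_colouring_gf:
  "tree_equation q (q ^ n) (\<lambda>T. colouring_gf q {0..n} (rep_tree T))"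
  unfolding tree_equation_def
proof
  fix T
  define G where "G = rep_tree T"
  interpret rtree G
    by unfold_locales (simp add: G_def rooted_tree_rep_tree)
  define A where "A = (\<lambda>T. colouring_gf q {0..n} (rep_tree T))"
  define b where "b = (if card V = 1 then 1 else 0 :: 'a)"
  have TG: "T = tree_class G"
    by (simp add: G_def tree_class_rep_tree)
  have A: "A (tree_class H) = colouring_gf q {0..n} H" if "rooted_tree H" for H
    unfolding A_def
    by (rule colouring_gf_iso[OF rooted_tree_rep_tree rooted_iso_rep_tree_class[OF that]])
  have susp: "q * suspension q A (tree_class H) = colouring_gf q {1..Suc n} H"
    if "rooted_tree H" for H
    using rtree.colouring_gf_shift[OF rtree.intro[OF that], of q n] that
    by (simp add: mult_suspension A num_verts_tree_class)
  have comp: "rooted_tree (induced G C (closest_to_root G C))" if "C \<in> components_of G (V - U)" for U C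
    using rooted_tree_component[OF _ that] by simp
  have b: "bullet T = b"
    by (simp add: TG bullet_tree_class tree b_def)
  have "crls A (\<lambda>T'. - bullet T') T =
      (\<Sum>U\<in>root_subtrees G. colouring_gf q {0..n} (induced G U r) *
        (\<Prod>C\<in>components_of G (V - U). - (if card C = 1 then 1 else 0)))"
    unfolding crls_def crls_graph_def G_def[symmetric]
    by (intro sum.cong arg_cong2[of _ _ _ _ times] prod.cong)
      (simp_all add: A rooted_tree_root_subtree comp bullet_tree_class)
  also have "\<dots> = colouring_gf q {1..n} G + b"
    unfolding b_def colouring_gf_no_zero_leaf[symmetric]
    by (rule sum_root_subtrees_colouring_gf) simp_all
  finally have lhs: "crls A (\<lambda>T'. - bullet T') T = colouring_gf q {1..n} G + b" .
  \<comment> \<open>Only \<open>U = {r}\<close> survives in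
    \<open>Crls\<diamond>(\<bullet>, B)\<close>, leaving a product over the components of the
    complement of the root.\<close>
  have single: "bullet (tree_class (induced G U r)) = (0 :: 'a)"
    if "U \<in> root_subtrees G - {{r}}" for U
    using that rooted_tree_root_subtree[of U]
    by (auto simp: bullet_tree_class root_subtrees_def card_1_singleton_iff)
  have "crls bullet (\<lambda>T'. q * suspension q A T') T =
      bullet (tree_class (induced G {r} r)) * (\<Prod>C\<in>components_of G (V - {r}).
        q * suspension q A (tree_class (induced G C (closest_to_root G C))))"
    unfolding crls_def crls_graph_def G_def[symmetric]
    by (subst sum.remove[OF finite_root_subtrees root_singleton_subtree]) (simp add: single)
  also have "\<dots> = (\<Prod>C\<in>components_of G (V - {r}).
      colouring_gf q {1..Suc n} (induced G C (closest_to_root G C)))"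
    using rooted_tree_root_subtree[OF root_singleton_subtree]
    by (simp add: bullet_tree_class susp comp del: One_nat_def)
  \<comment> \<open>The factor \<open>q * q ^ n\<close> is the weight of the root colour
    \<open>Suc n\<close>.\<close>
  finally have "q * q ^ n * crls bullet (\<lambda>T'. q * suspension q A T') T =
      (\<Sum>c\<in>{c \<in> colourings {1..Suc n} G. c r = Suc n}. weight q V c)"
    using sum_colourings_root_max[of "{1..Suc n}" "Suc n" q] by simp
  also have "\<dots> = colouring_gf q {1..Suc n} G - colouring_gf q {1..n} G"
    by (rule colouring_gf_diff[symmetric])
  finally have rhs: "q * q ^ n * crls bullet (\<lambda>T'. q * suspension q A T') T =
      colouring_gf q {1..Suc n} G - colouring_gf q {1..n} G" .
  \<comment> \<open>Both sides equal the difference for the palettes \<open>{1..Suc n}\<close> and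
    \<open>{1..n}\<close>, minus \<open>b\<close>.\<close>
  show "q * suspension q (\<lambda>T. colouring_gf q {0..n} (rep_tree T)) T -
      crls (\<lambda>T. colouring_gf q {0..n} (rep_tree T)) (\<lambda>T'. - bullet T') T =
      q * q ^ n * crls bullet
        (\<lambda>T'. q * suspension q (\<lambda>T. colouring_gf q {0..n} (rep_tree T)) T') T - bullet T"
    using lhs rhs susp[OF tree] b unfolding TG[symmetric] A_def[symmetric] by simp
qed


section \<open>Evaluation at quantum integers\<close>

text \<open>Otherwise the \<open>k\<close>-th power of the indeterminate would be the constant 1, of
  degree 0 instead of \<open>k\<close>.\<close>

lemma qelem_power_neq_1:
  assumes "k > 0"
  shows "qelem ^ k \<noteq> 1"
proof
  assume "qelem ^ k = 1"
  moreover have "qelem ^ k = Fract ([:0, 1:] ^ k) 1"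
    by (induction k) (simp_all add: qelem_def One_fract_def)
  ultimately have "([:0, 1:] :: rat poly) ^ k = 1"
    by (simp add: One_fract_def eq_fract)
  then have "degree (([:0, 1:] :: rat poly) ^ k) = 0"
    by simp
  then show False
    using assms by (simp add: degree_power_eq)
qed

lemma qx_power: "qx ^ k = [:qelem ^ k:]"
  by (induction k) (simp_all add: qx_def one_pCons)

lemma S_equation_S_series: "S_equation S_series"
proof -
  \<comment> \<open>These elements are nonzero constants, so they are inverted in the coefficient
    field \<open>\<rat>(q)\<close>.\<close>
  have inv: "(qx ^ k - 1) * [:inverse (qelem ^ k - 1):] = 1" if "k > 0" for k
    using qelem_power_neq_1[OF that] by (simp add: qx_power one_pCons)
  have "\<exists>A. S_equation A"
    unfolding S_equation_iff using inv by (rule tree_equation_exists)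
  moreover have "qx ^ k \<noteq> 1" if "k > 0" for k
    using inv[OF that] by auto
  then have "A = A'" if "S_equation A" "S_equation A'" for A A'
    using that unfolding S_equation_iff by (intro tree_equation_unique) auto
  ultimately have "\<exists>!A. S_equation A"
    by blast
  then show ?thesis
    unfolding S_series_def by (rule theI')
qed

lemma poly_S_series: "poly (S_series T) (qint n) = F_series n T"
proof -
  have "qelem - 1 \<noteq> 0"
    using qelem_power_neq_1[of 1] by simp
  \<comment> \<open>By the definition of \<open>[n]_q\<close>, the product
    \<open>(q - 1) [n]_q\<close> is \<open>q^n - 1\<close>.\<close>
  then have w: "poly (1 + (qx - 1) * xvar) (qint n) = qelem ^ n"
    by (simp add: qx_def xvar_def qint_def)
  have "tree_equation qelem (qelem ^ n) (\<lambda>T. poly (S_series T) (qint n))"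
    using tree_equation_poly[OF S_equation_S_series[unfolded S_equation_iff], of "qint n"]
    unfolding w by (simp add: qx_def)
  moreover have "tree_equation qelem (qelem ^ n) (F_series n)"
    using tree_equation_colouring_gf[of qelem n] by (simp add: F_series_def[abs_def] F_graph_eq)
  ultimately have "(\<lambda>T. poly (S_series T) (qint n)) = F_series n"
    using qelem_power_neq_1 by (intro tree_equation_unique) auto
  then show ?thesis
    by (rule fun_cong)
qed

text \<open>The second conjunct gives the formula on an arbitrary graph representing the tree,
  independently of the representative chosen by \<open>rep_tree\<close>.\<close>

theorem mainTheorem2:
  fixes n :: nat
  shows "eval_series (qint n) S_series = F_series n \<and>
    (\<forall>G. rooted_tree G \<longrightarrow>
       poly (S_series (tree_class G)) (qint n) =
         (\<Sum>c\<in>decreasing_colourings n G. qelem ^ (\<Sum>v\<in>verts G. c v)))"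
proof (intro conjI allI impI)
  show "eval_series (qint n) S_series = F_series n"
    by (simp add: fun_eq_iff eval_series_def poly_S_series)
  fix G assume "rooted_tree G"
  then have "F_series n (tree_class G) = F_graph n G"
    unfolding F_series_def F_graph_eq
    by (intro colouring_gf_iso rooted_tree_rep_tree rooted_iso_rep_tree_class)
  then show "poly (S_series (tree_class G)) (qint n) =
      (\<Sum>c\<in>decreasing_colourings n G. qelem ^ (\<Sum>v\<in>verts G. c v))"
    by (simp add: poly_S_series F_graph_def)
qed

end
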